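(* Let $V$ be a b-complete subsemimodule of $\mathbb{R}_{\max}^n$, let $x\in\mathbb{R}_{\max}^n$ with $x\notin V$, and let $$H'=\{h\in\mathbb{R}_{\max}^n\mid h\backslash x\leq h\backslash P_V(x)\}=\Big\{h\in\mathbb{R}_{\max}^n\ \Big|\ \max_{1\le j\le n}(h_j-x_j)\geq\max_{1\le j\le n}\big(h_j-P_V(x)_j\big)\Big\},$$ where $a-b:=a+(-b)$ with the convention $(-\infty)+(+\infty)=-\infty$. Then $$P_V(x)=P_{H'}(x).$$
   Context: $\mathbb{R}_{\max}=\mathbb{R}\cup\{-\infty\}$ with addition $\oplus=\max$ and multiplication $\otimes=+$; $\overline{\mathbb{R}}=\mathbb{R}\cup\{-\infty,+\infty\}$ with the convention $(-\infty)+(+\infty)=(+\infty)+(-\infty)=-\infty$. $\mathbb{R}_{\max}^n$ has the entrywise order, entrywise max as addition, and $x\lambda$ denotes the vector with entries $x_i+\lambda$. The symbol $-\infty$ also denotes the vector with all entries $-\infty$. For vectors $x,y$, $x\backslash y:=\max\{\lambda\in\overline{\mathbb{R}}\mid x\lambda\leq y\}$. A subsemimodule of $\mathbb{R}_{\max}^n$ is a subset containing the vector $-\infty$ and stable under entrywise max and under $x\mapsto x\lambda$ for all $\lambda\in\mathbb{R}_{\max}$; it is b-complete if the supremum of any of its subsets that is bounded from above belongs to it. For a b-complete subsemimodule $V$, $P_V(x):=\max\{v\in V\mid v\leq x\}$; $P_{H'}$ is defined in the same way. *)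

theory Defs
  imports "HOL-Library.Extended_Real"
begin

text \<open>
  Vectors are functions from a finite index type to \<^typ>\<open>ereal\<close>, with the pointwise order and
  lattice operations; the elements of the max-plus module are those without an entry \<open>\<infinity>\<close>.
\<close>

definition rmax_vecs :: "('n::finite \<Rightarrow> ereal) set" where
  "rmax_vecs = {x. \<forall>i. x i \<noteq> \<infinity>}"

text \<open>
  The sum \<open>-\<infinity> + \<infinity>\<close> of \<^typ>\<open>ereal\<close> is \<open>\<infinity>\<close>; here \<open>-\<infinity>\<close> has to be absorbing.
\<close>

definition mp_add :: "ereal \<Rightarrow> ereal \<Rightarrow> ereal" where
  "mp_add a b = (if a = -\<infinity> \<or> b = -\<infinity> then -\<infinity> else a + b)"

definition mp_diff :: "ereal \<Rightarrow> ereal \<Rightarrow> ereal" where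
  "mp_diff a b = mp_add a (- b)"

definition mp_scale :: "('n::finite \<Rightarrow> ereal) \<Rightarrow> ereal \<Rightarrow> ('n \<Rightarrow> ereal)" where
  "mp_scale x l = (\<lambda>i. mp_add (x i) l)"

definition residual :: "('n::finite \<Rightarrow> ereal) \<Rightarrow> ('n \<Rightarrow> ereal) \<Rightarrow> ereal" where
  "residual x y = (GREATEST l. mp_scale x l \<le> y)"

definition subsemimodule :: "('n::finite \<Rightarrow> ereal) set \<Rightarrow> bool" where
  "subsemimodule V \<longleftrightarrow>
     V \<subseteq> rmax_vecs \<and>
     (\<lambda>i. -\<infinity>) \<in> V \<and>
     (\<forall>v\<in>V. \<forall>w\<in>V. sup v w \<in> V) \<and>
     (\<forall>v\<in>V. \<forall>l. l \<noteq> \<infinity> \<longrightarrow> mp_scale v l \<in> V)"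

text \<open>
  Bounds are taken in \<^const>\<open>rmax_vecs\<close>. For sets bounded in this sense the pointwise
  supremum in \<^typ>\<open>ereal\<close> has no entry \<open>\<infinity>\<close>, so it is also the supremum in
  \<^const>\<open>rmax_vecs\<close>.
\<close>

definition b_complete :: "('n::finite \<Rightarrow> ereal) set \<Rightarrow> bool" where
  "b_complete V \<longleftrightarrow>
     (\<forall>A. A \<subseteq> V \<and> (\<exists>u\<in>rmax_vecs. \<forall>a\<in>A. a \<le> u) \<longrightarrow> Sup A \<in> V)"

definition proj :: "('n::finite \<Rightarrow> ereal) set \<Rightarrow> ('n \<Rightarrow> ereal) \<Rightarrow> ('n \<Rightarrow> ereal)" where
  "proj V x = (GREATEST v. v \<in> V \<and> v \<le> x)"

text \<open>The maxima in the definitions of \<^const>\<open>residual\<close> and \<^const>\<open>proj\<close> are attained.\<close>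

lemma mp_add_le_iff: "mp_add a l \<le> b \<longleftrightarrow> l \<le> - mp_diff a b"
  by (cases a; cases b; cases l) (auto simp: mp_add_def mp_diff_def)

lemma mp_scale_le_iff: "mp_scale x l \<le> y \<longleftrightarrow> l \<le> (INF i. - mp_diff (x i) (y i))"
  by (simp add: mp_scale_def le_fun_def mp_add_le_iff le_INF_iff)

lemma residual_greatest:
  shows "mp_scale x (residual x y) \<le> y"
    and "mp_scale x l \<le> y \<Longrightarrow> l \<le> residual x y"
proof -
  define r where "r = (INF i. - mp_diff (x i) (y i))"
  have r: "mp_scale x l \<le> y \<longleftrightarrow> l \<le> r" for l
    unfolding r_def by (rule mp_scale_le_iff)
  have eq: "residual x y = r"
    unfolding residual_def r by (rule Greatest_equality) (rule order_refl, assumption)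
  show "mp_scale x (residual x y) \<le> y"
    unfolding r eq by (rule order_refl)
  show "mp_scale x l \<le> y \<Longrightarrow> l \<le> residual x y"
    unfolding r eq .
qed

lemma proj_greatest:
  assumes "b_complete V" and "x \<in> rmax_vecs"
  shows "proj V x \<in> V" and "proj V x \<le> x"
    and "v \<in> V \<Longrightarrow> v \<le> x \<Longrightarrow> v \<le> proj V x"
proof -
  define p where "p = Sup {v \<in> V. v \<le> x}"
  have "{v \<in> V. v \<le> x} \<subseteq> V \<and> (\<exists>u\<in>rmax_vecs. \<forall>a\<in>{v \<in> V. v \<le> x}. a \<le> u)"
    using assms(2) by blast
  then have mem: "p \<in> V"
    unfolding p_def by (rule assms(1)[unfolded b_complete_def, THEN spec, THEN mp])
  have le: "p \<le> x"
    unfolding p_def by (rule Sup_least) blast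
  have max: "v \<le> p" if "v \<in> V \<and> v \<le> x" for v
    unfolding p_def using that by (intro Sup_upper CollectI)
  have "proj V x = p"
    unfolding proj_def by (rule Greatest_equality) (fact conjI[OF mem le], fact max)
  then show "proj V x \<in> V" and "proj V x \<le> x"
    and "v \<in> V \<Longrightarrow> v \<le> x \<Longrightarrow> v \<le> proj V x"
    using mem le max by (simp_all only:)
qed

end

theory Submission
  imports Defs
begin

text \<open>This is the Galois connection between scaling \<open>x\<close> and residuation by
  \<open>x\<close>: the admissible scalars form a down-set, bounded by an infimum that does not
  depend on \<open>l\<close>.\<close>

lemma le_residual_iff: "l \<le> residual x y \<longleftrightarrow> mp_scale x l \<le> y"
proof
  assume "l \<le> residual x y"
  also have "\<dots> \<le> (INF i. - mp_diff (x i) (y i))"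
    using residual_greatest(1) by (simp only: mp_scale_le_iff)
  finally show "mp_scale x l \<le> y"
    by (simp only: mp_scale_le_iff)
qed (rule residual_greatest(2))

lemma mp_scale_zero [simp]: "mp_scale x 0 = x"
  by (auto simp: mp_scale_def mp_add_def)

text \<open>Indirect equality: both sides have the same lower bounds \<open>l\<close>. Negation
  turns the infimum over coordinates into a maximum.\<close>

lemma residual_eq_uminus_Max:
  "residual x y = - (MAX j. mp_diff (x j) (y j))"
proof (rule order_antisym)
  have "l \<le> residual x y \<longleftrightarrow> l \<le> - (MAX j. mp_diff (x j) (y j))" for l
  proof -
    have "l \<le> residual x y \<longleftrightarrow> (\<forall>j. l \<le> - mp_diff (x j) (y j))"
      by (simp add: le_residual_iff mp_scale_le_iff le_INF_iff)
    also have "\<dots> \<longleftrightarrow> (\<forall>j. mp_diff (x j) (y j) \<le> - l)"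
      by (simp only: ereal_minus_le_minus[symmetric, of _ "- l"] ereal_uminus_uminus)
    \<comment> \<open>The index type is finite and nonempty, so the maximum is a least upper
      bound.\<close>
    also have "\<dots> \<longleftrightarrow> (MAX j. mp_diff (x j) (y j)) \<le> - l"
      by simp
    also have "\<dots> \<longleftrightarrow> l \<le> - (MAX j. mp_diff (x j) (y j))"
      by (simp only: ereal_minus_le_minus[symmetric, of _ "- l"] ereal_uminus_uminus)
    finally show ?thesis .
  qed
  then show "residual x y \<le> - (MAX j. mp_diff (x j) (y j))"
    and "- (MAX j. mp_diff (x j) (y j)) \<le> residual x y"
    by blast+
qed

text \<open>Exhibiting a greatest element pins down \<open>GREATEST\<close> directly, without going
  through \<open>b_complete\<close>; this serves for the set \<open>H'\<close>.\<close>

lemma proj_unique: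
  assumes "p \<in> V" "p \<le> x" "\<And>v. v \<in> V \<Longrightarrow> v \<le> x \<Longrightarrow> v \<le> p"
  shows "proj V x = p"
  unfolding proj_def by (rule Greatest_equality) (use assms in auto)

text \<open>This puts the projection into \<open>H'\<close>: any scaling of it that stays below
  \<open>x\<close> is dominated by the projection itself, by maximality in \<open>V\<close>.\<close>

lemma residual_proj_le:
  assumes "subsemimodule V" and "b_complete V" and "x \<in> rmax_vecs"
  shows "residual (proj V x) x \<le> residual (proj V x) (proj V x)"
proof -
  note p = proj_greatest[OF assms(2,3)]
  define l where "l = residual (proj V x) x"
  have le: "mp_scale (proj V x) l \<le> x"
    unfolding l_def by (rule residual_greatest(1))
  have "mp_scale (proj V x) l \<le> proj V x"
  proof (cases "l = \<infinity>")
    case True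
    \<comment> \<open>Semimodules are only closed under scalars \<open>\<noteq> \<infinity>\<close>, but here the projection is \<open>-\<infinity>\<close>,
      since \<open>x\<close> has no entry \<open>\<infinity>\<close>.\<close>
    have fin: "mp_add (proj V x i) \<infinity> \<noteq> \<infinity>" for i
      using le assms(3) True
      by (auto simp: le_fun_def mp_scale_def rmax_vecs_def dest: spec[of _ i])
    have "proj V x i = -\<infinity>" for i
      using fin[of i] by (cases "proj V x i") (auto simp: mp_add_def)
    then show ?thesis
      by (auto simp: le_fun_def mp_scale_def mp_add_def)
  next
    case False
    with assms(1) p(1) have "mp_scale (proj V x) l \<in> V"
      unfolding subsemimodule_def by blast
    then show ?thesis
      using le by (rule p(3))
  qed
  then show ?thesis
    unfolding l_def by (rule residual_greatest(2))
qed

text \<open>Since 0 is the unit scalar, \<open>h \<le> x\<close> amounts to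
  \<open>0 \<le> residual h x\<close>, and this bound passes along the assumed inequality. It yields
  maximality of the projection in \<open>H'\<close>.\<close>

lemma le_of_residual_le:
  assumes "residual h x \<le> residual h y" and "h \<le> x"
  shows "h \<le> y"
proof -
  have "0 \<le> residual h x"
    using assms(2) by (simp add: le_residual_iff)
  also note assms(1)
  finally show ?thesis
    by (simp add: le_residual_iff)
qed

theorem corollary4p4:
  fixes V H' :: "('n::finite \<Rightarrow> ereal) set" and x :: "'n \<Rightarrow> ereal"
  assumes "subsemimodule V" and "b_complete V"
    and "x \<in> rmax_vecs" and "x \<notin> V"
    and "H' = {h \<in> rmax_vecs. residual h x \<le> residual h (proj V x)}"
  shows "H' = {h \<in> rmax_vecs.
                 (MAX j. mp_diff (h j) (x j)) \<ge> (MAX j. mp_diff (h j) (proj V x j))} \<and>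
         (proj H' x \<in> H' \<and> proj H' x \<le> x \<and> (\<forall>h\<in>H'. h \<le> x \<longrightarrow> h \<le> proj H' x)) \<and>
         proj V x = proj H' x"
proof -
  note p = proj_greatest[OF assms(2,3)]
  have "proj V x \<in> rmax_vecs"
    using p(1) assms(1) by (auto simp: subsemimodule_def)
  then have mem: "proj V x \<in> H'"
    using residual_proj_le[OF assms(1-3)] assms(5) by simp
  have max: "h \<le> proj V x" if "h \<in> H'" "h \<le> x" for h
    using that assms(5) by (auto intro: le_of_residual_le)
  have "proj H' x = proj V x"
    using mem p(2) max by (rule proj_unique)
  moreover have "H' = {h \<in> rmax_vecs.
      (MAX j. mp_diff (h j) (x j)) \<ge> (MAX j. mp_diff (h j) (proj V x j))}"
    \<comment> \<open>The minus sign in front of each maximum reverses the inequality between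
      residuals.\<close>
    unfolding assms(5) residual_eq_uminus_Max ereal_minus_le_minus ..
  ultimately show ?thesis
    using mem p(2) max by simp
qed

end
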